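(* Let $\Omega\subset\mathbb{R}^n$, and let $f\in C(\mathbb{R}_+)$, where $\mathbb{R}_+$ is the set of non-negative numbers. Suppose that $f$ is non-decreasing and that $$0\le f(\delta t)\le M\delta^3 f(t),$$ with $M>0$, $t>0$ bounded and $\delta>0$ small. Let $u$ be a non-negative viscosity solution of $\Delta_\infty u=f(u)$ in $\Omega$. If $\{u=0\}\cap\Omega\neq\emptyset$, then $u\equiv 0$.
   Context: The infinity Laplacian is $\Delta_\infty u(x):=\sum_{i,j=1}^n u_{x_i}u_{x_j}u_{x_ix_j}$, with $u_{x_i}=\partial u/\partial x_i$. Viscosity solutions: a function $u\in C(\Omega)$ is a viscosity super-solution of $\Delta_\infty u=f(u)$ in $\Omega$ if for every $\phi\in C^2(\Omega)$ such that $u-\phi$ has a local minimum at $x_0\in\Omega$, with $\phi(x_0)=u(x_0)$, one has $\Delta_\infty\phi(x_0)\le f(\phi(x_0))$. It is a viscosity sub-solution if for every $\phi\in C^2(\Omega)$ such that $u-\phi$ has a local maximum at $x_0\in\Omega$, with $\phi(x_0)=u(x_0)$, one has $\Delta_\infty\phi(x_0)\ge f(\phi(x_0))$. It is a viscosity solution if it is both a viscosity super-solution and a viscosity sub-solution.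
   Formalization: Ω is taken to be open and connected (a domain); without connectedness the claim fails, e.g. f ≡ 0 on two disjoint balls with u = 0 on one and u = 1 on the other. *)

theory Defs
  imports "HOL-Analysis.Analysis"
begin

definition partial_deriv :: "'n::finite \<Rightarrow> (real^'n \<Rightarrow> real) \<Rightarrow> real^'n \<Rightarrow> real" where
  "partial_deriv i \<phi> x = deriv (\<lambda>t. \<phi> (x + t *\<^sub>R axis i 1)) 0"

definition C1_on :: "(real^'n::finite) set \<Rightarrow> (real^'n \<Rightarrow> real) \<Rightarrow> bool" where
  "C1_on \<Omega> \<phi> \<longleftrightarrow> continuous_on \<Omega> \<phi> \<and>
     (\<forall>i. (\<forall>x\<in>\<Omega>. (\<lambda>t. \<phi> (x + t *\<^sub>R axis i 1)) differentiable (at 0)) \<and>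
          continuous_on \<Omega> (partial_deriv i \<phi>))"

(* For open \<Omega>: all partial derivatives of order at most two exist and are continuous
   in \<Omega>.  The values of \<phi> outside \<Omega> are irrelevant. *)
definition C2_on :: "(real^'n::finite) set \<Rightarrow> (real^'n \<Rightarrow> real) \<Rightarrow> bool" where
  "C2_on \<Omega> \<phi> \<longleftrightarrow> C1_on \<Omega> \<phi> \<and> (\<forall>i. C1_on \<Omega> (partial_deriv i \<phi>))"

definition inf_laplacian :: "(real^'n::finite \<Rightarrow> real) \<Rightarrow> real^'n \<Rightarrow> real" where
  "inf_laplacian \<phi> x =
     (\<Sum>i\<in>UNIV. \<Sum>j\<in>UNIV. partial_deriv i \<phi> x * partial_deriv j \<phi> x *
        partial_deriv j (partial_deriv i \<phi>) x)"

(* f is only ever evaluated at values \<phi> x0 = u x0, so for non-negative u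
   only its restriction to the half-line {0..} matters. *)
definition viscosity_supersolution ::
    "(real \<Rightarrow> real) \<Rightarrow> (real^'n::finite) set \<Rightarrow> (real^'n \<Rightarrow> real) \<Rightarrow> bool" where
  "viscosity_supersolution f \<Omega> u \<longleftrightarrow> continuous_on \<Omega> u \<and>
     (\<forall>\<phi> x0. C2_on \<Omega> \<phi> \<longrightarrow> x0 \<in> \<Omega> \<longrightarrow>
        (\<forall>\<^sub>F y in at x0 within \<Omega>. u x0 - \<phi> x0 \<le> u y - \<phi> y) \<longrightarrow>
        \<phi> x0 = u x0 \<longrightarrow> inf_laplacian \<phi> x0 \<le> f (\<phi> x0))"

definition viscosity_subsolution ::
    "(real \<Rightarrow> real) \<Rightarrow> (real^'n::finite) set \<Rightarrow> (real^'n \<Rightarrow> real) \<Rightarrow> bool" where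
  "viscosity_subsolution f \<Omega> u \<longleftrightarrow> continuous_on \<Omega> u \<and>
     (\<forall>\<phi> x0. C2_on \<Omega> \<phi> \<longrightarrow> x0 \<in> \<Omega> \<longrightarrow>
        (\<forall>\<^sub>F y in at x0 within \<Omega>. u y - \<phi> y \<le> u x0 - \<phi> x0) \<longrightarrow>
        \<phi> x0 = u x0 \<longrightarrow> inf_laplacian \<phi> x0 \<ge> f (\<phi> x0))"

definition viscosity_solution ::
    "(real \<Rightarrow> real) \<Rightarrow> (real^'n::finite) set \<Rightarrow> (real^'n \<Rightarrow> real) \<Rightarrow> bool" where
  "viscosity_solution f \<Omega> u \<longleftrightarrow>
     viscosity_supersolution f \<Omega> u \<and> viscosity_subsolution f \<Omega> u"

end

theory Submission
  imports Defs
begin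

text \<open>
  Since \<open>f s \<le> C * s ^ 3\<close> for small \<open>s\<close>, the function \<open>u\<close> is near its zero set a supersolution of
  an equation that scales like the infinity Laplacian itself. If \<open>u\<close> does not vanish identically,
  some ball in \<open>{u > 0}\<close> touches the zero set at a boundary point \<open>z\<close>. On the outer half of that
  ball the Gaussian barrier \<open>\<epsilon> * (exp (- \<alpha> * r\<^sup>2) - exp (- \<alpha> * R\<^sup>2))\<close> with \<open>\<alpha>\<close> large is a strict
  subsolution for every small \<open>\<epsilon>\<close>. Sliding the barrier under \<open>u\<close> it touches \<open>u\<close> from below
  at a point off the inner sphere, and there the strict inequality contradicts the
  supersolution property.
\<close>

text \<open>The offset \<open>b\<close> is a parameter so that a barrier and its vertical translates
  form one family, while the first and second derivatives are multiples of the member with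
  \<open>b = 0\<close>.\<close>

definition gauss :: "real \<Rightarrow> real \<Rightarrow> real \<Rightarrow> real^'n::finite \<Rightarrow> real^'n \<Rightarrow> real" where
  "gauss \<alpha> a b y x = a * exp (- \<alpha> * (norm (x - y))\<^sup>2) + b"

lemma norm_axis_expand:
  fixes v :: "real^'n::finite"
  shows "(norm (v + t *\<^sub>R axis i 1))\<^sup>2 = (norm v)\<^sup>2 + 2 * t * v $ i + t\<^sup>2"
proof -
  have "axis i (1::real) \<bullet> axis i 1 = 1"
    by (simp add: inner_axis_axis)
  then show ?thesis
    unfolding power2_norm_eq_inner
    by (simp add: inner_add_left inner_add_right inner_axis inner_axis' power2_eq_square
        distrib_left)
qed

lemma gauss_axis_derivative:
  "((\<lambda>t. gauss \<alpha> a b y (x + t *\<^sub>R axis i 1)) has_real_derivative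
     - 2 * \<alpha> * (x - y) $ i * gauss \<alpha> a 0 y x) (at 0)"
proof -
  have eq: "gauss \<alpha> a b y (x + t *\<^sub>R axis i 1) =
      a * exp (- \<alpha> * ((norm (x - y))\<^sup>2 + 2 * t * (x - y) $ i + t\<^sup>2)) + b" for t
    using norm_axis_expand[of "x - y" t i] by (simp add: gauss_def diff_add_eq)
  show ?thesis
    unfolding eq by (auto intro!: derivative_eq_intros simp: gauss_def)
qed

lemma component_axis_derivative:
  fixes x y :: "real^'n::finite"
  shows "((\<lambda>t. (x + t *\<^sub>R axis j 1 - y) $ i) has_real_derivative (if i = j then 1 else 0)) (at 0)"
  by (auto intro!: derivative_eq_intros simp: axis_def)

lemma partial_deriv_gauss:
  "partial_deriv i (gauss \<alpha> a b y) = (\<lambda>x. - 2 * \<alpha> * (x - y) $ i * gauss \<alpha> a 0 y x)"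
  unfolding partial_deriv_def by (rule ext) (rule DERIV_imp_deriv[OF gauss_axis_derivative])

lemma gauss_axis_derivative2:
  "((\<lambda>t. - 2 * \<alpha> * (x + t *\<^sub>R axis j 1 - y) $ i * gauss \<alpha> a 0 y (x + t *\<^sub>R axis j 1))
     has_real_derivative
       (4 * \<alpha>\<^sup>2 * (x - y) $ i * (x - y) $ j - (if i = j then 2 * \<alpha> else 0)) * gauss \<alpha> a 0 y x) (at 0)"
proof -
  have "((\<lambda>t. (- 2 * \<alpha>) * ((x + t *\<^sub>R axis j 1 - y) $ i * gauss \<alpha> a 0 y (x + t *\<^sub>R axis j 1)))
     has_real_derivative
       (- 2 * \<alpha>) * ((if i = j then 1 else 0) * gauss \<alpha> a 0 y (x + 0 *\<^sub>R axis j 1)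
         + (- 2 * \<alpha> * (x - y) $ j * gauss \<alpha> a 0 y x) * (x + 0 *\<^sub>R axis j 1 - y) $ i)) (at 0)"
    by (intro DERIV_cmult DERIV_mult component_axis_derivative gauss_axis_derivative)
  then show ?thesis
    by (rule DERIV_cong_ev[THEN iffD1, rotated -1])
       (auto simp: algebra_simps power2_eq_square)
qed

lemma partial_deriv2_gauss:
  "partial_deriv j (partial_deriv i (gauss \<alpha> a b y)) =
     (\<lambda>x. (4 * \<alpha>\<^sup>2 * (x - y) $ i * (x - y) $ j - (if i = j then 2 * \<alpha> else 0)) * gauss \<alpha> a 0 y x)"
  unfolding partial_deriv_gauss
  by (rule ext, subst partial_deriv_def) (rule DERIV_imp_deriv[OF gauss_axis_derivative2])

lemma continuous_on_gauss [continuous_intros]: "continuous_on S (gauss \<alpha> a b y)"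
  unfolding gauss_def by (intro continuous_intros)

lemma C2_on_gauss: "C2_on \<Omega> (gauss \<alpha> a b y)"
proof -
  have "C1_on \<Omega> (gauss \<alpha> a b y)"
    unfolding C1_on_def partial_deriv_gauss
    using gauss_axis_derivative real_differentiable_def
    by (fastforce intro!: continuous_intros)
  moreover have "C1_on \<Omega> (partial_deriv i (gauss \<alpha> a b y))" for i
    unfolding C1_on_def partial_deriv2_gauss
    using gauss_axis_derivative2 real_differentiable_def
    by (fastforce intro!: continuous_intros simp: partial_deriv_gauss)
  ultimately show ?thesis
    by (simp add: C2_on_def)
qed

text \<open>With \<open>v = x - y\<close> and \<open>G = gauss \<alpha> a 0 y x\<close>, the
  gradient is -2 \<alpha> G v and the Hessian is G (4 \<alpha>^2 v v^T - 2 \<alpha> I); the infinity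
  Laplacian is the Hessian form evaluated at the gradient. In terms of s = \<alpha> |v|^2, for
  positive \<alpha> and \<open>a\<close>, it is positive exactly when s > 1/2. The factor
  \<open>G ^ 3\<close> is what a cubic bound on \<open>f\<close> can be compared with.\<close>

lemma inf_laplacian_gauss:
  fixes x y :: "real^'n::finite"
  shows "inf_laplacian (gauss \<alpha> a b y) x =
    4 * \<alpha>\<^sup>2 * (4 * (\<alpha> * (norm (x - y))\<^sup>2)\<^sup>2 - 2 * (\<alpha> * (norm (x - y))\<^sup>2)) * (gauss \<alpha> a 0 y x) ^ 3"
proof -
  define v where "v = x - y"
  define G where "G = gauss \<alpha> a 0 y x"
  have N: "(norm v)\<^sup>2 = (\<Sum>i\<in>UNIV. (v $ i)\<^sup>2)"
    unfolding power2_norm_eq_inner by (simp add: inner_vec_def power2_eq_square)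
  have N2: "(norm v)\<^sup>2 * (norm v)\<^sup>2 = (\<Sum>i\<in>UNIV. \<Sum>j\<in>UNIV. (v $ i)\<^sup>2 * (v $ j)\<^sup>2)"
    unfolding N by (rule sum_product)
  have "inf_laplacian (gauss \<alpha> a b y) x =
    (\<Sum>i\<in>UNIV. \<Sum>j\<in>UNIV. 16 * \<alpha> ^ 4 * G ^ 3 * ((v $ i)\<^sup>2 * (v $ j)\<^sup>2)
       - (if i = j then 8 * \<alpha> ^ 3 * G ^ 3 * (v $ i)\<^sup>2 else 0))"
    unfolding inf_laplacian_def partial_deriv2_gauss unfolding partial_deriv_gauss
      v_def[symmetric] G_def[symmetric]
    by (intro sum.cong refl) (auto simp: power_def algebra_simps numeral_eq_Suc)
  also have "\<dots> = 16 * \<alpha> ^ 4 * G ^ 3 * ((norm v)\<^sup>2 * (norm v)\<^sup>2) - 8 * \<alpha> ^ 3 * G ^ 3 * (norm v)\<^sup>2"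
    unfolding N2 unfolding N by (simp add: sum_subtractf sum_distrib_left)
  finally show ?thesis
    unfolding v_def[symmetric] G_def[symmetric]
    by (simp add: algebra_simps power_def numeral_eq_Suc)
qed

text \<open>By connectedness the zero set cannot be open, so some zero \<open>a\<close> has nonzero
  points \<open>y\<close> arbitrarily close to it. The ball around such a \<open>y\<close> that
  reaches out to a nearest zero is the required one.\<close>

lemma touching_ball:
  fixes \<Omega> :: "'a::heine_borel set" and u :: "'a \<Rightarrow> real"
  assumes "open \<Omega>" "connected \<Omega>" and cont: "continuous_on \<Omega> u"
    and "a0 \<in> \<Omega>" "u a0 = 0" and "p \<in> \<Omega>" "u p \<noteq> 0"
  obtains y z where "cball y (dist y z) \<subseteq> \<Omega>" "0 < dist y z" "u z = 0"
    "\<forall>x\<in>ball y (dist y z). u x \<noteq> 0"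
proof -
  define Z where "Z = {x\<in>\<Omega>. u x = 0}"
  have "closedin (top_of_set \<Omega>) Z"
    unfolding Z_def using continuous_closedin_preimage_constant[OF cont, of 0] .
  moreover have "Z \<noteq> {}" "Z \<noteq> \<Omega>"
    using assms by (auto simp: Z_def)
  ultimately have "\<not> openin (top_of_set \<Omega>) Z"
    using \<open>connected \<Omega>\<close> connected_clopen by blast
  then have "\<not> open Z"
    using openin_open_eq[OF \<open>open \<Omega>\<close>] by (auto simp: Z_def)
  then obtain a where a: "a \<in> Z" "\<And>e. 0 < e \<Longrightarrow> \<not> ball a e \<subseteq> Z"
    unfolding open_contains_ball by blast
  obtain d where d: "0 < d" "cball a d \<subseteq> \<Omega>"
    using a(1) \<open>open \<Omega>\<close> unfolding Z_def open_contains_cball by blast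
  \<comment> \<open>Half of \<open>d\<close> leaves room: a ball around \<open>y\<close> of radius
    at most \<open>dist a y\<close> stays inside \<open>cball a d\<close>.\<close>
  obtain y where y: "dist a y < d / 2" "y \<notin> Z"
    using a(2)[of "d / 2"] d(1) by (auto simp: subset_iff)
  have "closed (Z \<inter> cball a d)"
  proof -
    have "Z \<inter> cball a d = {x \<in> cball a d. u x = 0}"
      using d(2) by (auto simp: Z_def)
    then show ?thesis
      using continuous_closed_preimage_constant[OF continuous_on_subset[OF cont d(2)]] by simp
  qed
  \<comment> \<open>Restricting to \<open>cball a d\<close> gives a closed set, so a nearest zero
    exists. No closer zero is missed, because the resulting ball lies in
    \<open>cball a d\<close>.\<close>
  then obtain z where z: "z \<in> Z \<inter> cball a d" "\<And>x. x \<in> Z \<inter> cball a d \<Longrightarrow> dist y z \<le> dist y x"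
    using distance_attains_inf[of "Z \<inter> cball a d" y] a(1) d(1)
    by (metis IntI centre_in_cball empty_iff less_imp_le)
  have le: "dist y z \<le> dist a y"
    using z(2)[of a] a(1) d(1) by (simp add: dist_commute)
  have sub: "cball y (dist y z) \<subseteq> cball a d"
  proof
    fix x assume "x \<in> cball y (dist y z)"
    then show "x \<in> cball a d"
      using dist_triangle[of a x y] le y(1) by simp
  qed
  show ?thesis
  proof (rule that[of y z])
    show "cball y (dist y z) \<subseteq> \<Omega>" using sub d(2) by blast
    show "0 < dist y z" using z(1) y(2) by auto
    show "u z = 0" using z(1) by (simp add: Z_def)
    show "\<forall>x\<in>ball y (dist y z). u x \<noteq> 0"
    proof
      fix x assume x: "x \<in> ball y (dist y z)"
      then have "x \<in> cball a d" using sub ball_subset_cball by blast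
      then show "u x \<noteq> 0"
        using z(2)[of x] x d(2) by (auto simp: Z_def)
    qed
  qed
qed

text \<open>A Hopf-type argument: strict positivity inside the ball leaves room for a small barrier
  that vanishes on the bounding sphere, and the zero at \<open>z\<close> forces this barrier to
  touch \<open>u\<close> after a downward shift.\<close>

lemma supersolution_not_touching:
  fixes \<Omega> :: "(real^'n::finite) set"
  assumes super: "viscosity_supersolution f \<Omega> u" and nonneg: "\<forall>x\<in>\<Omega>. 0 \<le> u x"
    and mono: "mono_on {0..} f"
    and cubic: "0 \<le> C" "0 < s0" "\<And>s. 0 \<le> s \<Longrightarrow> s \<le> s0 \<Longrightarrow> f s \<le> C * s ^ 3"
    and R: "0 < R" "cball y R \<subseteq> \<Omega>" and pos: "\<forall>x\<in>ball y R. 0 < u x"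
    and z: "dist y z = R" "u z = 0"
  shows False
proof -
  have cont: "continuous_on \<Omega> u"
    using super by (simp add: viscosity_supersolution_def)
  \<comment> \<open>The summand 4/R^2 makes \<alpha> |x - y|^2 at least 1 outside the inner ball;
    \<open>C + 1\<close> gives \<alpha> > 1 and \<alpha> > C, hence C < \<alpha>^2.\<close>
  define \<alpha> where "\<alpha> = 4 / R\<^sup>2 + C + 1"
  have \<alpha>: "0 < \<alpha>" "1 \<le> \<alpha> * (R / 2)\<^sup>2" "C < 8 * \<alpha>\<^sup>2"
  proof -
    have *: "0 < 4 / R\<^sup>2" using R by simp
    then show "0 < \<alpha>" using cubic(1) unfolding \<alpha>_def by linarith
    have "4 / R\<^sup>2 * (R / 2)\<^sup>2 \<le> \<alpha> * (R / 2)\<^sup>2"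
      using cubic by (intro mult_right_mono) (auto simp: \<alpha>_def)
    then show "1 \<le> \<alpha> * (R / 2)\<^sup>2" using R by (simp add: field_simps)
    have "1 < \<alpha>" "C < \<alpha>" using * cubic(1) unfolding \<alpha>_def by linarith+
    moreover from this have "\<alpha> < \<alpha>\<^sup>2" by (simp add: power2_eq_square)
    ultimately show "C < 8 * \<alpha>\<^sup>2" by linarith
  qed
  obtain c where c: "0 < c" "\<And>x. x \<in> sphere y (R / 2) \<Longrightarrow> c \<le> u x"
  proof (cases "sphere y (R / 2) = {}")
    case True
    then show ?thesis using that[of 1] by auto
  next
    case False
    have sub: "sphere y (R / 2) \<subseteq> ball y R" using R by auto
    then have "continuous_on (sphere y (R / 2)) u"
      using R continuous_on_subset[OF cont] ball_subset_cball by blast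
    then obtain w where "w \<in> sphere y (R / 2)" "\<forall>x\<in>sphere y (R / 2). u w \<le> u x"
      using continuous_attains_inf[OF compact_sphere False] by blast
    then show ?thesis using that[of "u w"] sub pos by blast
  qed
  \<comment> \<open>Being below \<open>c\<close> keeps the barrier under \<open>u\<close> on the
    inner sphere; being at most \<open>s0\<close> keeps its values in the range of the cubic
    bound.\<close>
  define \<epsilon> where "\<epsilon> = min (c / 2) s0"
  have \<epsilon>: "0 < \<epsilon>" "\<epsilon> < c" "\<epsilon> \<le> s0" using c cubic by (auto simp: \<epsilon>_def)
  \<comment> \<open>This offset makes the barrier vanish on the outer sphere, which contains
    \<open>z\<close>.\<close>
  define b where "b = - \<epsilon> * exp (- \<alpha> * R\<^sup>2)"
  define \<phi> where "\<phi> = gauss \<alpha> \<epsilon> b y"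
  define K where "K = cball y R - ball y (R / 2)"
  have "compact K" unfolding K_def by (intro compact_diff) auto
  have "z \<in> K" using z R by (simp add: K_def)
  have "K \<subseteq> \<Omega>" using R by (auto simp: K_def)
  have "continuous_on K (\<lambda>x. u x - \<phi> x)"
    unfolding \<phi>_def using \<open>K \<subseteq> \<Omega>\<close> by (intro continuous_intros continuous_on_subset[OF cont])
  then obtain x0 where x0: "x0 \<in> K" "\<And>x. x \<in> K \<Longrightarrow> u x0 - \<phi> x0 \<le> u x - \<phi> x"
    using continuous_attains_inf[OF \<open>compact K\<close>] \<open>z \<in> K\<close> by blast
  have \<phi>_le: "\<phi> x < gauss \<alpha> \<epsilon> 0 y x" "gauss \<alpha> \<epsilon> 0 y x \<le> \<epsilon>" for x
    using \<epsilon> \<alpha> by (auto simp: \<phi>_def b_def gauss_def)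
  have \<phi>_outside: "\<phi> x \<le> 0" if "R \<le> dist y x" for x
  proof -
    have "\<alpha> * R\<^sup>2 \<le> \<alpha> * (norm (x - y))\<^sup>2"
      using that R \<alpha> by (intro mult_left_mono power_mono) (auto simp: dist_norm norm_minus_commute)
    then show ?thesis using \<epsilon> by (simp add: \<phi>_def b_def gauss_def)
  qed
  have \<phi>z: "\<phi> z = 0"
    using z by (simp add: \<phi>_def b_def gauss_def dist_norm norm_minus_commute)
  have below: "u x0 \<le> \<phi> x0"
    using x0(2)[OF \<open>z \<in> K\<close>] \<phi>z z by simp
  have x0\<Omega>: "x0 \<in> \<Omega>" using x0 \<open>K \<subseteq> \<Omega>\<close> by blast
  \<comment> \<open>On the inner sphere \<open>u\<close> is at least \<open>c\<close>, hence above
    \<epsilon> and above the barrier, against \<open>below\<close>.\<close>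
  have "dist y x0 \<noteq> R / 2"
    using c(2)[of x0] below \<phi>_le[of x0] \<epsilon> by auto
  then have inner: "R / 2 < dist y x0" using x0(1) by (auto simp: K_def)
  \<comment> \<open>The minimum point may lie on the outer sphere, so points outside
    \<open>K\<close> need a separate argument: there the barrier is at most 0, so
    \<open>u - \<phi>\<close> is nonnegative, whereas its value at \<open>x0\<close> is at most
    0.\<close>
  have touch: "\<forall>\<^sub>F x in at x0 within \<Omega>. u x0 - \<phi> x0 \<le> u x - \<phi> x"
  proof -
    have "\<forall>\<^sub>F x in at x0 within \<Omega>. R / 2 < dist y x"
      using inner by (rule order_tendstoD(1)[OF tendsto_dist[OF tendsto_const tendsto_ident_at]])
    moreover have "\<forall>\<^sub>F x in at x0 within \<Omega>. x \<in> \<Omega>"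
      by (simp add: eventually_at_filter)
    ultimately show ?thesis
    proof eventually_elim
      case (elim x)
      show ?case
      proof (cases "R \<le> dist y x")
        case True
        then show ?thesis using \<phi>_outside[of x] nonneg elim(2) below by force
      next
        case False
        then show ?thesis using x0(2)[of x] elim(1) by (simp add: K_def)
      qed
    qed
  qed
  \<comment> \<open>Test functions must agree with \<open>u\<close> at \<open>x0\<close>; the
    constant shift achieves this and leaves the derivatives unchanged.\<close>
  define \<psi> where "\<psi> = gauss \<alpha> \<epsilon> (b + (u x0 - \<phi> x0)) y"
  have \<psi>: "\<psi> x = \<phi> x + (u x0 - \<phi> x0)" for x
    by (simp add: \<psi>_def \<phi>_def gauss_def)
  have C2: "C2_on \<Omega> \<psi>" by (simp add: \<psi>_def C2_on_gauss)
  have "\<forall>\<^sub>F x in at x0 within \<Omega>. u x0 - \<psi> x0 \<le> u x - \<psi> x"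
    using touch by (auto simp: \<psi> elim!: eventually_mono)
  then have le: "inf_laplacian \<psi> x0 \<le> f (u x0)"
    using super x0\<Omega> C2 \<psi>[of x0] unfolding viscosity_supersolution_def by fastforce
  define G where "G = gauss \<alpha> \<epsilon> 0 y x0"
  have u0: "0 \<le> u x0" using nonneg x0\<Omega> by blast
  have G: "0 < G" using \<epsilon> by (simp add: G_def gauss_def)
  \<comment> \<open>The chain passes from \<open>u x0\<close> up to the barrier value and then to
    \<open>G\<close>, the Gaussian without offset. Since \<open>G\<close> is positive even where the
    barrier vanishes, the comparison of constants stays strict.\<close>
  have "f (u x0) \<le> f (\<phi> x0)"
    using mono_onD[OF mono, of "u x0" "\<phi> x0"] u0 below by simp
  also have "\<dots> \<le> C * \<phi> x0 ^ 3"
    using cubic(3)[of "\<phi> x0"] \<phi>_le[of x0] u0 below \<epsilon> by simp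
  also have "\<dots> \<le> C * G ^ 3"
    using cubic(1) \<phi>_le[of x0] u0 below unfolding G_def
    by (intro mult_left_mono power_mono) auto
  also have "\<dots> < 8 * \<alpha>\<^sup>2 * G ^ 3"
    using \<alpha>(3) G by simp
  also have "\<dots> \<le> inf_laplacian \<psi> x0"
  proof -
    define s where "s = \<alpha> * (norm (x0 - y))\<^sup>2"
    have "\<alpha> * (R / 2)\<^sup>2 \<le> s"
      unfolding s_def using inner R \<alpha>
      by (intro mult_left_mono power_mono) (auto simp: dist_norm norm_minus_commute)
    then have "1 \<le> s" using \<alpha>(2) by linarith
    \<comment> \<open>The product equals 2 s^2 - s - 1, so doubling it gives the next bound.\<close>
    then have "0 \<le> (s - 1) * (2 * s + 1)" by simp
    then have "2 \<le> 4 * s\<^sup>2 - 2 * s"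
      by (simp add: algebra_simps power2_eq_square)
    then have "4 * \<alpha>\<^sup>2 * 2 * G ^ 3 \<le> 4 * \<alpha>\<^sup>2 * (4 * s\<^sup>2 - 2 * s) * G ^ 3"
      using G by (intro mult_right_mono mult_left_mono) auto
    then show ?thesis
      by (simp add: \<psi>_def inf_laplacian_gauss G_def s_def)
  qed
  finally show False using le by simp
qed

theorem theorem6p1:
  fixes \<Omega> :: "(real^'n::finite) set"
    and f :: "real \<Rightarrow> real"
    and u :: "real^'n \<Rightarrow> real"
  assumes "open \<Omega>" and "connected \<Omega>"
    and "continuous_on {0..} f"
    and "mono_on {0..} f"
    and "\<forall>T>0. \<exists>M>0. \<exists>\<delta>0>0. \<forall>t \<delta>. 0 < t \<and> t \<le> T \<and> 0 < \<delta> \<and> \<delta> \<le> \<delta>0 \<longrightarrow>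
           0 \<le> f (\<delta> * t) \<and> f (\<delta> * t) \<le> M * \<delta> ^ 3 * f t"
    and "viscosity_solution f \<Omega> u"
    and "\<forall>x\<in>\<Omega>. 0 \<le> u x"
    and "{x. u x = 0} \<inter> \<Omega> \<noteq> {}"
  shows "\<forall>x\<in>\<Omega>. u x = 0"
proof (rule ccontr)
  assume "\<not> ?thesis"
  then obtain p where p: "p \<in> \<Omega>" "u p \<noteq> 0" by blast
  obtain a where a: "a \<in> \<Omega>" "u a = 0" using assms(8) by blast
  have super: "viscosity_supersolution f \<Omega> u"
    using assms(6) by (simp add: viscosity_solution_def)
  then have cont: "continuous_on \<Omega> u"
    by (simp add: viscosity_supersolution_def)
  obtain y z where yz: "cball y (dist y z) \<subseteq> \<Omega>" "0 < dist y z" "u z = 0"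
    "\<forall>x\<in>ball y (dist y z). u x \<noteq> 0"
    using touching_ball[OF assms(1,2) cont a p] .
  then have pos: "\<forall>x\<in>ball y (dist y z). 0 < u x"
    using assms(7) by (metis ball_subset_cball order_le_less subsetD)
  obtain M s0 where M: "0 < s0"
    "\<And>t \<delta>. 0 < t \<and> t \<le> 1 \<and> 0 < \<delta> \<and> \<delta> \<le> s0 \<Longrightarrow> f (\<delta> * t) \<le> M * \<delta> ^ 3 * f t"
    using assms(5) by (metis zero_less_one)
  \<comment> \<open>The growth hypothesis is applied with \<open>T = 1\<close>, \<open>t = 1\<close>
    and \<open>\<delta> = s\<close>; the absolute value supplies a nonnegative constant.\<close>
  have small: "f s \<le> \<bar>M * f 1\<bar> * s ^ 3" if "0 < s" "s \<le> s0" for s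
  proof -
    have "f s \<le> (M * f 1) * s ^ 3" using M(2)[of 1 s] that by (simp add: mult_ac)
    also have "\<dots> \<le> \<bar>M * f 1\<bar> * s ^ 3" using that by (intro mult_right_mono) auto
    finally show ?thesis .
  qed
  \<comment> \<open>The growth hypothesis reaches only positive arguments. At 0, monotonicity gives
    \<open>f 0 \<le> f s\<close>, and the cubic bound on \<open>f s\<close> tends to 0 as
    \<open>s\<close> decreases to 0.\<close>
  have "f 0 \<le> 0"
  proof (rule tendsto_lowerbound)
    show "((\<lambda>s. \<bar>M * f 1\<bar> * s ^ 3) \<longlongrightarrow> 0) (at_right 0)"
      by (auto intro!: tendsto_eq_intros)
    have "\<forall>\<^sub>F s in at_right 0. s \<in> {0<..<s0}"
      using M(1) by (rule eventually_at_right_real)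
    then show "\<forall>\<^sub>F s in at_right 0. f 0 \<le> \<bar>M * f 1\<bar> * s ^ 3"
    proof eventually_elim
      case (elim s)
      then show ?case
        using small[of s] mono_onD[OF assms(4), of 0 s] by simp
    qed
  qed simp
  with small have "f s \<le> \<bar>M * f 1\<bar> * s ^ 3" if "0 \<le> s" "s \<le> s0" for s
    using that by (cases "s = 0") auto
  then show False
    using supersolution_not_touching[OF super assms(7,4) _ M(1) _ yz(2,1) pos refl yz(3)]
    by (meson abs_ge_zero)
qed

end
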